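(* Let $X$ be a simplex in a topological vector space $E$, let $Y$ be a Hausdorff space which is a nonempty subset of a topological vector space, and let $T,G:X\to 2^{Y}$ be correspondences satisfying: (a) $T$ is weakly naturally quasi-concave and compact; (b) for each $y\in T(X)$, the set $G^{-1}(y)$ is convex; (c) $\overline{T(X)}=\bigcup_{x\in X}\operatorname{Int}G(x)$. Then there exists $x^{\ast}\in X$ such that $T(x^{\ast})\cap G(x^{\ast})\neq\emptyset$.
   Context: A correspondence $T:X\to 2^{Y}$ assigns to each $x\in X$ a subset $T(x)\subset Y$; $T(X)=\bigcup_{x\in X}T(x)$, and $G^{-1}(y)=\{x\in X: y\in G(x)\}$. Closures and interiors are taken in $Y$. $T$ is compact if $\overline{T(X)}$ is compact. Let $\Delta_{n-1}=\{(\lambda_1,\dots,\lambda_n)\in\mathbb{R}^n:\sum_i\lambda_i=1,\ \lambda_i\ge 0\}$. Let $C^{\ast}(\Delta_{n-1})$ be the set of maps $g=(g_1,\dots,g_n):\Delta_{n-1}\to\Delta_{n-1}$, $(\lambda_1,\dots,\lambda_n)\mapsto(g_1(\lambda_1),\dots,g_n(\lambda_n))$, where each $g_i$ is continuous with $g_i(1)=1$ and $g_i(0)=0$. For $X$ a nonempty convex subset of a topological vector space and $Y$ a nonempty subset of a topological vector space, $T:X\to 2^{Y}$ is weakly naturally quasi-concave if for each $n\ge 1$ and each finite set $\{x_1,\dots,x_n\}\subset X$ there exist $y_i\in T(x_i)$ ($i=1,\dots,n$) and $g\in C^{\ast}(\Delta_{n-1})$ such that $\sum_{i=1}^{n}g_i(\lambda_i)y_i\in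 T\left(\sum_{i=1}^{n}\lambda_i x_i\right)$ for every $(\lambda_1,\dots,\lambda_n)\in\Delta_{n-1}$. *)

theory Defs
  imports "HOL-Analysis.Analysis" "HOL-Homology.Simplices"
begin

text \<open>Real topological vector spaces; no separation axiom is assumed.\<close>

class real_tvs = real_vector + topological_ab_group_add +
  assumes tendsto_scaleR_Pair_tvs:
    "filterlim (\<lambda>p. fst p *\<^sub>R snd p) (nhds (c *\<^sub>R a)) (nhds (c::real) \<times>\<^sub>F nhds a)"

instance real_normed_vector \<subseteq> real_tvs
proof
  fix c :: real and a :: 'a
  show "filterlim (\<lambda>p. fst p *\<^sub>R snd p) (nhds (c *\<^sub>R a)) (nhds c \<times>\<^sub>F nhds a)"
    by (intro tendsto_scaleR filterlim_fst filterlim_snd)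
qed

text \<open>The constant \<^const>\<open>simplex\<close> of the library is restricted to Euclidean spaces; the following
  covers arbitrary real vector spaces. A simplex is nonempty.\<close>

definition is_simplex :: "'a::real_vector set \<Rightarrow> bool" where
  "is_simplex S \<longleftrightarrow>
     (\<exists>C. finite C \<and> C \<noteq> {} \<and> \<not> affine_dependent C \<and> S = convex hull C)"

text \<open>\<^term>\<open>standard_simplex p\<close> is the simplex $\Delta_p$, with coordinates indexed by
  \<open>0, \<dots>, p\<close> instead of \<open>1, \<dots>, n\<close>, where \<open>n = p + 1 \<ge> 1\<close>.\<close>

definition Cstar :: "nat \<Rightarrow> ((nat \<Rightarrow> real) \<Rightarrow> (nat \<Rightarrow> real)) set" where
  "Cstar p =
     {g. g ` standard_simplex p \<subseteq> standard_simplex p \<and>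
         (\<exists>h :: nat \<Rightarrow> real \<Rightarrow> real.
            \<forall>i\<le>p. continuous_on {0..1} (h i) \<and> h i 1 = 1 \<and> h i 0 = 0 \<and>
                  (\<forall>l\<in>standard_simplex p. g l i = h i (l i)))}"

text \<open>The points \<open>x 0, \<dots>, x p\<close> enumerate a finite subset of \<open>X\<close>, hence are pairwise distinct.\<close>

definition weakly_naturally_quasi_concave ::
    "'a::real_vector set \<Rightarrow> ('a \<Rightarrow> 'b::real_vector set) \<Rightarrow> bool" where
  "weakly_naturally_quasi_concave X T \<longleftrightarrow>
     (\<forall>p. \<forall>x. inj_on x {..p} \<and> x ` {..p} \<subseteq> X \<longrightarrow>
        (\<exists>y. (\<forall>i\<le>p. y i \<in> T (x i)) \<and>
             (\<exists>g\<in>Cstar p. \<forall>l\<in>standard_simplex p.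
                (\<Sum>i\<le>p. g l i *\<^sub>R y i) \<in> T (\<Sum>i\<le>p. l i *\<^sub>R x i))))"

definition correspondence :: "'a set \<Rightarrow> 'b set \<Rightarrow> ('a \<Rightarrow> 'b set) \<Rightarrow> bool" where
  "correspondence X Y T \<longleftrightarrow> (\<forall>x\<in>X. T x \<subseteq> Y)"

definition corr_image :: "'a set \<Rightarrow> ('a \<Rightarrow> 'b set) \<Rightarrow> 'b set" where
  "corr_image X T = (\<Union>x\<in>X. T x)"

definition corr_inverse :: "'a set \<Rightarrow> ('a \<Rightarrow> 'b set) \<Rightarrow> 'b \<Rightarrow> 'a set" where
  "corr_inverse X G y = {x\<in>X. y \<in> G x}"

text \<open>Closures are taken relative to \<open>Y\<close>.\<close>

definition compact_correspondence ::
    "'a set \<Rightarrow> 'b::topological_space set \<Rightarrow> ('a \<Rightarrow> 'b set) \<Rightarrow> bool" where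
  "compact_correspondence X Y T \<longleftrightarrow> compact (top_of_set Y closure_of corr_image X T)"

end

theory Submission
  imports Defs
begin

text \<open>
  Let \<open>X\<close> be the hull of the distinct points \<open>x 0, \<dots>, x p\<close>, and write \<open>m l = (\<Sum>i\<le>p. l i *\<^sub>R x i)\<close> for the
  point with coordinates \<open>l\<close> in the standard simplex. Weak natural quasi-concavity, applied to
  the vertices only, provides \<open>y\<close> and \<open>g\<close> such that \<open>s l = (\<Sum>i\<le>p. g l i *\<^sub>R y i)\<close> lies in
  \<open>T (m l)\<close>. This \<open>s\<close> is continuous because each coordinate of \<open>g\<close> is, so \<open>T\<close> has a continuous
  selection along the parametrisation \<open>m\<close>, and it remains to find \<open>l\<close> with \<open>s l \<in> G (m l)\<close>,
  that is, with \<open>m l\<close> in the convex set \<open>corr_inverse X G (s l)\<close>.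

  This is a fixed point problem of Fan--Browder type (lemma \<open>fan_browder_barycentric\<close>). The
  preimages under \<open>s\<close> of the relative interiors of the sets \<open>G z\<close> form an open cover of the
  standard simplex, which is compact and metrizable. A partition of unity subordinate to a finite
  subcover moves every \<open>l\<close> to a convex combination of points \<open>z\<close> with \<open>s l \<in> G z\<close>, hence into
  \<open>corr_inverse X G (s l)\<close>. In barycentric coordinates this is a continuous self-map of the
  standard simplex, and a fixed point of it is the required \<open>l\<close>.

  The number of vertices is a variable, so Brouwer's theorem is needed for simplices of every
  dimension inside the single type \<^typ>\<open>nat \<Rightarrow> real\<close>, where it is not an instance of the theorem for
  Euclidean spaces. It is derived from Kuhn's combinatorial lemma: cells of finer and
  finer grids in the cube give a point fixed in any prescribed finite number of coordinates (lemma
  \<open>hilbert_cube_fixes_coordinates\<close>), and a retraction transfers this to the simplex (lemma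
  \<open>brouwer_standard_simplex\<close>).
\<close>

section \<open>Fixing finitely many coordinates in the Hilbert cube\<close>

lemma tendsto_fun_iff:
  fixes f :: "'c \<Rightarrow> 'i \<Rightarrow> 'd::topological_space"
  shows "(f \<longlongrightarrow> l) F \<longleftrightarrow> (\<forall>i. ((\<lambda>x. f x i) \<longlongrightarrow> l i) F)"
  using limitin_componentwise[where I = UNIV and X = "\<lambda>_. euclidean" and f = f and l = l and F = F]
  by (simp add: euclidean_product_topology)

abbreviation hilbert_cube :: "(nat \<Rightarrow> real) set" where
  "hilbert_cube \<equiv> UNIV \<rightarrow>\<^sub>E {0..1}"

lemma compact_hilbert_cube: "compact hilbert_cube"
proof -
  have "compactin (powertop_real UNIV) hilbert_cube"
    by (simp add: compactin_PiE)
  then show ?thesis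
    by (simp add: euclidean_product_topology)
qed

text \<open>
  Kuhn's lemma on the grid of mesh \<open>1 / q\<close>. A grid point gets label \<open>0\<close> in direction \<open>i\<close> only if \<open>f\<close> does
  not decrease its \<open>i\<close>-th coordinate, and label \<open>1\<close> only if \<open>f\<close> does not increase it; \<open>r\<close> and \<open>s\<close> are
  vertices of one cell whose labels in direction \<open>i\<close> differ.
\<close>

lemma kuhn_cell_hilbert_cube:
  fixes f :: "(nat \<Rightarrow> real) \<Rightarrow> nat \<Rightarrow> real"
  assumes f: "f \<in> hilbert_cube \<rightarrow> hilbert_cube" and q: "0 < q"
  shows "\<exists>a\<in>hilbert_cube. \<forall>i<n. \<exists>r\<in>hilbert_cube. \<exists>s\<in>hilbert_cube.
           (\<forall>j. \<bar>r j - a j\<bar> \<le> 1 / real q) \<and> (\<forall>j. \<bar>s j - a j\<bar> \<le> 1 / real q) \<and>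
           r i \<le> f r i \<and> f s i \<le> s i"
proof -
  define pt :: "(nat \<Rightarrow> nat) \<Rightarrow> nat \<Rightarrow> real"
    where "pt x = (\<lambda>j. if j < n then real (x j) / real q else 0)" for x
  \<comment> \<open>On the two faces orthogonal to \<open>i\<close> the lemma prescribes the label. This is consistent, since
     \<open>f\<close> maps into the cube and so cannot move a point of a face outwards.\<close>
  define label :: "(nat \<Rightarrow> nat) \<Rightarrow> nat \<Rightarrow> nat"
    where "label x i = (if x i = 0 then 0 else if x i = q then 1
                        else if pt x i \<le> f (pt x) i then 0 else 1)" for x i
  have pt: "pt x \<in> hilbert_cube" if "\<forall>j<n. x j \<le> q" for x
    using that q by (auto simp: pt_def)
  have fpt: "0 \<le> f (pt x) i" "f (pt x) i \<le> 1" if "\<forall>j<n. x j \<le> q" for x i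
    using f pt[OF that] by (auto simp: Pi_iff PiE_iff)
  have label0: "pt x i \<le> f (pt x) i" if "\<forall>j<n. x j \<le> q" "label x i = 0" for x i
    using that fpt[OF that(1), of i] q by (auto simp: label_def pt_def split: if_splits)
  have label1: "f (pt x) i \<le> pt x i" if "\<forall>j<n. x j \<le> q" "label x i \<noteq> 0" "i < n" for x i
    using that fpt[OF that(1), of i] q by (auto simp: label_def pt_def split: if_splits)
  obtain b where b: "\<forall>i<n. b i < q"
    and cell: "\<forall>i<n. \<exists>r s. (\<forall>j<n. b j \<le> r j \<and> r j \<le> b j + 1) \<and>
                 (\<forall>j<n. b j \<le> s j \<and> s j \<le> b j + 1) \<and> label r i \<noteq> label s i"
    by (rule kuhn_lemma[of q n label]) (use q in \<open>auto simp: label_def\<close>)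
  show ?thesis
  proof (rule bexI[of _ "pt b"], intro allI impI)
    show "pt b \<in> hilbert_cube"
      by (rule pt) (use b in \<open>auto intro: less_imp_le\<close>)
    fix i assume i: "i < n"
    have near: "(\<forall>j<n. r j \<le> q) \<and> (\<forall>j. \<bar>pt r j - pt b j\<bar> \<le> 1 / real q)"
      if "\<forall>j<n. b j \<le> r j \<and> r j \<le> b j + 1" for r
    proof (intro conjI allI impI)
      fix j assume "j < n"
      then show "r j \<le> q" using that b by (metis Suc_eq_plus1 Suc_leI le_trans)
    next
      fix j
      show "\<bar>pt r j - pt b j\<bar> \<le> 1 / real q"
      proof (cases "j < n")
        case True
        then have "\<bar>real (r j) - real (b j)\<bar> \<le> 1" using that by fastforce
        then show ?thesis
          using True q divide_right_mono[of "\<bar>real (r j) - real (b j)\<bar>" 1 "real q"]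
          by (simp add: pt_def abs_divide flip: diff_divide_distrib)
      qed (simp add: pt_def)
    qed
    obtain r s where rs: "\<forall>j<n. b j \<le> r j \<and> r j \<le> b j + 1"
      "\<forall>j<n. b j \<le> s j \<and> s j \<le> b j + 1" "label r i \<noteq> label s i"
      using cell i by blast
    have "\<exists>r s. (\<forall>j<n. b j \<le> r j \<and> r j \<le> b j + 1) \<and>
        (\<forall>j<n. b j \<le> s j \<and> s j \<le> b j + 1) \<and> label r i = 0 \<and> label s i \<noteq> 0"
    proof (cases "label r i = 0")
      case True
      then show ?thesis using rs by (intro exI[of _ r] exI[of _ s]) auto
    next
      case False
      then have "label s i = 0" using rs(3) by (auto simp: label_def split: if_splits)
      with False show ?thesis using rs by (intro exI[of _ s] exI[of _ r]) auto
    qed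
    then obtain r s where r: "\<forall>j<n. b j \<le> r j \<and> r j \<le> b j + 1" "label r i = 0"
      and s: "\<forall>j<n. b j \<le> s j \<and> s j \<le> b j + 1" "label s i \<noteq> 0"
      by blast
    show "\<exists>r\<in>hilbert_cube. \<exists>s\<in>hilbert_cube.
           (\<forall>j. \<bar>r j - pt b j\<bar> \<le> 1 / real q) \<and> (\<forall>j. \<bar>s j - pt b j\<bar> \<le> 1 / real q) \<and>
           r i \<le> f r i \<and> f s i \<le> s i"
      using near[OF r(1)] near[OF s(1)] pt label0[OF _ r(2)] label1[OF _ s(2) i]
      by (intro bexI[of _ "pt r"] bexI[of _ "pt s"]) auto
  qed
qed

text \<open>
  The cells of the previous lemma shrink to a point \<open>u\<close> along a subsequence. In the limit their
  vertices \<open>r\<close> and \<open>s\<close> turn into the two inequalities between \<open>u i\<close> and \<open>f u i\<close>.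
\<close>

lemma hilbert_cube_fixes_coordinates:
  fixes f :: "(nat \<Rightarrow> real) \<Rightarrow> nat \<Rightarrow> real"
  assumes cont: "continuous_on hilbert_cube f" and f: "f \<in> hilbert_cube \<rightarrow> hilbert_cube"
  shows "\<exists>u\<in>hilbert_cube. \<forall>i<n. f u i = u i"
proof -
  have "\<forall>k. \<exists>a\<in>hilbert_cube. \<forall>i<n. \<exists>r\<in>hilbert_cube. \<exists>s\<in>hilbert_cube.
           (\<forall>j. \<bar>r j - a j\<bar> \<le> 1 / real (Suc k)) \<and> (\<forall>j. \<bar>s j - a j\<bar> \<le> 1 / real (Suc k)) \<and>
           r i \<le> f r i \<and> f s i \<le> s i"
    using kuhn_cell_hilbert_cube[OF f] by blast
  then obtain a where a: "\<And>k. a k \<in> hilbert_cube"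
    and cell: "\<And>k i. i < n \<Longrightarrow> \<exists>r\<in>hilbert_cube. \<exists>s\<in>hilbert_cube.
           (\<forall>j. \<bar>r j - a k j\<bar> \<le> 1 / real (Suc k)) \<and> (\<forall>j. \<bar>s j - a k j\<bar> \<le> 1 / real (Suc k)) \<and>
           r i \<le> f r i \<and> f s i \<le> s i"
    by metis
  obtain u \<phi> where u: "u \<in> hilbert_cube" and \<phi>: "strict_mono \<phi>" and lim: "(a \<circ> \<phi>) \<longlonglongrightarrow> u"
    using compact_imp_seq_compact[OF compact_hilbert_cube] a by (metis seq_compactE)
  have near: "(r \<circ> \<phi>) \<longlonglongrightarrow> u \<and> (\<lambda>k. f (r (\<phi> k))) \<longlonglongrightarrow> f u"
    if r: "\<And>k. r k \<in> hilbert_cube" "\<And>k j. \<bar>r k j - a k j\<bar> \<le> 1 / real (Suc k)" for r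
  proof
    show lim_r: "(r \<circ> \<phi>) \<longlonglongrightarrow> u"
      unfolding tendsto_fun_iff
    proof
      fix j
      have "(\<lambda>k. 1 / real (Suc (\<phi> k))) \<longlonglongrightarrow> 0"
        using LIMSEQ_subseq_LIMSEQ[OF LIMSEQ_inverse_real_of_nat \<phi>]
        by (simp add: o_def inverse_eq_divide)
      then have "(\<lambda>k. r (\<phi> k) j - a (\<phi> k) j) \<longlonglongrightarrow> 0"
        by (rule Lim_null_comparison[rotated]) (use r in auto)
      moreover have "(\<lambda>k. a (\<phi> k) j) \<longlonglongrightarrow> u j"
        using lim by (simp add: tendsto_fun_iff)
      ultimately show "(\<lambda>k. (r \<circ> \<phi>) k j) \<longlonglongrightarrow> u j"
        using tendsto_add by fastforce
    qed
    show "(\<lambda>k. f (r (\<phi> k))) \<longlonglongrightarrow> f u"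
      using continuous_on_tendsto_compose[OF cont lim_r u] r(1) by (simp add: o_def)
  qed
  have "f u i = u i" if i: "i < n" for i
  proof -
    obtain r s where r: "\<And>k. r k \<in> hilbert_cube" "\<And>k j. \<bar>r k j - a k j\<bar> \<le> 1 / real (Suc k)"
      "\<And>k. r k i \<le> f (r k) i"
      and s: "\<And>k. s k \<in> hilbert_cube" "\<And>k j. \<bar>s k j - a k j\<bar> \<le> 1 / real (Suc k)"
      "\<And>k. f (s k) i \<le> s k i"
      using cell[OF i] by metis
    have "u i \<le> f u i"
      by (rule LIMSEQ_le[of "\<lambda>k. r (\<phi> k) i" _ "\<lambda>k. f (r (\<phi> k)) i"])
        (use near[OF r(1,2)] r(3) in \<open>auto simp: tendsto_fun_iff\<close>)
    moreover have "f u i \<le> u i"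
      by (rule LIMSEQ_le[of "\<lambda>k. f (s (\<phi> k)) i" _ "\<lambda>k. s (\<phi> k) i"])
        (use near[OF s(1,2)] s(3) in \<open>auto simp: tendsto_fun_iff\<close>)
    ultimately show ?thesis by simp
  qed
  with u show ?thesis by blast
qed

section \<open>Brouwer's fixed point theorem for the standard simplex\<close>

text \<open>
  A point whose coordinate sum is below \<open>1\<close> has the deficit spread equally over the coordinates; one
  whose sum is above \<open>1\<close> is scaled down. The two \<open>max\<close> terms join both cases continuously.
\<close>

definition simplex_retraction :: "nat \<Rightarrow> (nat \<Rightarrow> real) \<Rightarrow> nat \<Rightarrow> real" where
  "simplex_retraction p u = (\<lambda>i. if i \<le> p
     then (u i + max 0 (1 - (\<Sum>j\<le>p. u j)) / real (Suc p)) / max 1 (\<Sum>j\<le>p. u j) else 0)"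

lemma continuous_on_simplex_retraction: "continuous_on S (simplex_retraction p)"
  unfolding simplex_retraction_def
proof (rule continuous_on_coordinatewise_then_product)
  show "continuous_on S (\<lambda>u. if i \<le> p
     then (u i + max 0 (1 - (\<Sum>j\<le>p. u j)) / real (Suc p)) / max 1 (\<Sum>j\<le>p. u j) else 0)" for i
    by (cases "i \<le> p")
      (auto intro!: continuous_intros continuous_on_subset[OF continuous_on_product_coordinates])
qed

lemma standard_simplexI:
  assumes "\<And>i. i \<le> p \<Longrightarrow> 0 \<le> l i" "\<And>i. p < i \<Longrightarrow> l i = 0" "(\<Sum>i\<le>p. l i) = 1"
  shows "l \<in> standard_simplex p"
proof -
  have "l i \<le> 1" for i
  proof (cases "i \<le> p")
    case True
    then have "l i \<le> (\<Sum>i\<le>p. l i)"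
      by (intro member_le_sum) (use assms in auto)
    then show ?thesis using assms by simp
  qed (use assms in auto)
  moreover have "0 \<le> l i" for i
    using assms(1,2)[of i] by (cases "i \<le> p") auto
  ultimately show ?thesis
    using assms by (auto simp: standard_simplex_def)
qed

lemma simplex_retraction_mem:
  assumes "u \<in> hilbert_cube"
  shows "simplex_retraction p u \<in> standard_simplex p"
proof (rule standard_simplexI)
  have u: "0 \<le> u i" for i using assms by (auto simp: PiE_iff)
  then show "0 \<le> simplex_retraction p u i" for i
    by (auto simp: simplex_retraction_def)
  have "(\<Sum>i\<le>p. simplex_retraction p u i)
        = ((\<Sum>j\<le>p. u j) + max 0 (1 - (\<Sum>j\<le>p. u j))) / max 1 (\<Sum>j\<le>p. u j)"
    by (simp add: simplex_retraction_def sum.distrib flip: sum_divide_distrib)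
  also have "\<dots> = 1"
    by (simp add: max_def)
  finally show "(\<Sum>i\<le>p. simplex_retraction p u i) = 1" .
qed (auto simp: simplex_retraction_def)

text \<open>
  The retraction sees only the coordinates up to \<open>p\<close>. Hence it suffices that \<open>u\<close> agrees there with
  a point of the simplex, which is all that fixing finitely many coordinates can provide.
\<close>

lemma simplex_retraction_id:
  assumes "v \<in> standard_simplex p" "\<And>i. i \<le> p \<Longrightarrow> u i = v i"
  shows "simplex_retraction p u = v"
proof -
  have "(\<Sum>i\<le>p. u i) = 1"
    using assms by (simp add: standard_simplex_def)
  then show ?thesis
    using assms by (auto simp: simplex_retraction_def standard_simplex_def)
qed

lemma brouwer_standard_simplex:
  assumes cont: "continuous_on (standard_simplex p) f"
    and f: "f \<in> standard_simplex p \<rightarrow> standard_simplex p"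
  shows "\<exists>l\<in>standard_simplex p. f l = l"
proof -
  let ?h = "f \<circ> simplex_retraction p"
  have h: "?h u \<in> standard_simplex p" if "u \<in> hilbert_cube" for u
    using f simplex_retraction_mem[OF that] by auto
  have "continuous_on hilbert_cube ?h"
    by (intro continuous_on_compose continuous_on_simplex_retraction continuous_on_subset[OF cont])
      (use simplex_retraction_mem in blast)
  moreover have "?h \<in> hilbert_cube \<rightarrow> hilbert_cube"
    using h standard_simplex_01 by blast
  ultimately have "\<exists>u\<in>hilbert_cube. \<forall>i<Suc p. ?h u i = u i"
    by (rule hilbert_cube_fixes_coordinates)
  then obtain u where u: "u \<in> hilbert_cube" "\<And>i. i \<le> p \<Longrightarrow> ?h u i = u i"
    by (auto simp: less_Suc_eq_le)
  have "simplex_retraction p u = ?h u"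
    by (rule simplex_retraction_id[OF h[OF u(1)] u(2)[symmetric]])
  then have "f (simplex_retraction p u) = simplex_retraction p u"
    by simp
  then show ?thesis
    using simplex_retraction_mem[OF u(1)] by blast
qed

section \<open>A Fan--Browder fixed point lemma in barycentric coordinates\<close>

lemma convex_hull_standard_simplex:
  fixes x :: "nat \<Rightarrow> 'a::real_vector"
  assumes "inj_on x {..p}"
  shows "convex hull (x ` {..p}) = (\<lambda>l. \<Sum>i\<le>p. l i *\<^sub>R x i) ` standard_simplex p" (is "?H = ?R")
proof
  show "?H \<subseteq> ?R"
  proof
    fix z assume "z \<in> ?H"
    then obtain c where c: "\<And>y. y \<in> x ` {..p} \<Longrightarrow> 0 \<le> c y" "sum c (x ` {..p}) = 1"
      "(\<Sum>y\<in>x ` {..p}. c y *\<^sub>R y) = z"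
      by (auto simp: convex_hull_finite)
    have "(\<lambda>i. if i \<le> p then c (x i) else 0) \<in> standard_simplex p"
      using c assms by (intro standard_simplexI) (auto simp: sum.reindex)
    then show "z \<in> ?R"
      using c(3) assms by (intro image_eqI) (auto simp: sum.reindex)
  qed
  show "?R \<subseteq> ?H"
    by (auto simp: standard_simplex_def intro!: convex_sum intro: hull_inc)
qed

text \<open>
  The assumptions say that the convex-valued correspondence \<open>A\<close> contains one with open fibres \<open>U z\<close>
  that is nowhere empty. A partition of unity subordinate to the fibres
  then yields a continuous selection of \<open>A\<close>, to which Brouwer's theorem applies. Parameters \<open>l\<close>
  and points \<open>z\<close> of the hull are kept apart, so that continuity is required only on the standard
  simplex, where the topology is metrizable.
\<close>

lemma fan_browder_barycentric:
  fixes x :: "nat \<Rightarrow> 'a::real_vector"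
  assumes inj: "inj_on x {..p}"
    and op: "\<And>z. z \<in> convex hull (x ` {..p}) \<Longrightarrow> openin (top_of_set (standard_simplex p)) (U z)"
    and cover: "standard_simplex p \<subseteq> (\<Union>z\<in>convex hull (x ` {..p}). U z)"
    and A: "\<And>l. l \<in> standard_simplex p \<Longrightarrow> convex (A l)"
    and UA: "\<And>z l. \<lbrakk>z \<in> convex hull (x ` {..p}); l \<in> U z\<rbrakk> \<Longrightarrow> z \<in> A l"
  shows "\<exists>l\<in>standard_simplex p. (\<Sum>i\<le>p. l i *\<^sub>R x i) \<in> A l"
proof -
  let ?\<Delta> = "standard_simplex p" and ?X = "convex hull (x ` {..p})"
  have "compact ?\<Delta>"
    using compactin_standard_simplex[of p] by (simp add: euclidean_product_topology)
  obtain V where V: "\<And>z. z \<in> ?X \<Longrightarrow> open (V z) \<and> U z = ?\<Delta> \<inter> V z"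
    using op unfolding openin_open by metis
  have "?\<Delta> \<subseteq> \<Union>(V ` ?X)" using cover V by blast
  then obtain D where D: "D \<subseteq> ?X" "finite D" "?\<Delta> \<subseteq> \<Union>(V ` D)"
    using compactE_image[OF \<open>compact ?\<Delta>\<close>, of ?X V] V by metis
  obtain \<phi> where \<phi>: "\<And>W. W \<in> V ` D \<Longrightarrow> continuous_on ?\<Delta> (\<phi> W) \<and> (\<forall>l\<in>?\<Delta>. 0 \<le> \<phi> W l)"
    "\<And>l W. \<lbrakk>W \<in> V ` D; l \<in> ?\<Delta>; l \<notin> W\<rbrakk> \<Longrightarrow> \<phi> W l = 0"
    "\<And>l. l \<in> ?\<Delta> \<Longrightarrow> supp_sum (\<lambda>W. \<phi> W l) (V ` D) = (1::real)"
    by (rule subordinate_partition_of_unity[of ?\<Delta> "V ` D"]) (use D V in auto)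
  have sum1: "(\<Sum>W\<in>V ` D. \<phi> W l) = 1" if "l \<in> ?\<Delta>" for l
  proof -
    have "supp_sum (\<lambda>W. \<phi> W l) (V ` D) = (\<Sum>W\<in>V ` D. \<phi> W l)"
      unfolding supp_sum_def support_on_def by (rule sum.mono_neutral_left) (use D in auto)
    then show ?thesis using \<phi>(3)[OF that] by simp
  qed
  define node where "node W = (SOME z. z \<in> D \<and> V z = W)" for W
  have node: "node W \<in> D" "V (node W) = W" if "W \<in> V ` D" for W
    using that someI_ex[of "\<lambda>z. z \<in> D \<and> V z = W"] unfolding node_def by auto
  have "\<forall>W\<in>V ` D. \<exists>c\<in>?\<Delta>. node W = (\<Sum>i\<le>p. c i *\<^sub>R x i)"
    using node(1) D(1) unfolding convex_hull_standard_simplex[OF inj] by blast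
  then obtain c where c: "\<And>W. W \<in> V ` D \<Longrightarrow> c W \<in> ?\<Delta>"
    "\<And>W. W \<in> V ` D \<Longrightarrow> node W = (\<Sum>i\<le>p. c W i *\<^sub>R x i)"
    by metis
  \<comment> \<open>The barycentric coordinates of \<open>\<Sum>W\<in>V ` D. \<phi> W l *\<^sub>R node W\<close>.\<close>
  define f where "f l = (\<lambda>i. \<Sum>W\<in>V ` D. \<phi> W l * c W i)" for l
  have "continuous_on ?\<Delta> f"
    unfolding f_def using \<phi>(1)
    by (intro continuous_on_coordinatewise_then_product continuous_intros) auto
  moreover have "f \<in> ?\<Delta> \<rightarrow> ?\<Delta>"
  proof (intro funcsetI standard_simplexI)
    fix l i assume l: "l \<in> ?\<Delta>"
    show "0 \<le> f l i"
      unfolding f_def using \<phi>(1) l c(1)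
      by (intro sum_nonneg mult_nonneg_nonneg) (auto simp: standard_simplex_def)
    show "f l i = 0" if "p < i"
      unfolding f_def using that c(1) by (intro sum.neutral) (auto simp: standard_simplex_def)
    have "(\<Sum>i\<le>p. f l i) = (\<Sum>W\<in>V ` D. \<phi> W l * (\<Sum>i\<le>p. c W i))"
      unfolding f_def by (subst sum.swap) (simp add: sum_distrib_left)
    also have "\<dots> = (\<Sum>W\<in>V ` D. \<phi> W l)"
      using c(1) by (intro sum.cong) (auto simp: standard_simplex_def)
    finally show "(\<Sum>i\<le>p. f l i) = 1"
      using sum1[OF l] by simp
  qed
  ultimately obtain l where l: "l \<in> ?\<Delta>" "f l = l"
    using brouwer_standard_simplex by blast
  have "(\<Sum>i\<le>p. l i *\<^sub>R x i) = (\<Sum>i\<le>p. f l i *\<^sub>R x i)"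
    using l by simp
  also have "\<dots> = (\<Sum>W\<in>V ` D. \<phi> W l *\<^sub>R (\<Sum>i\<le>p. c W i *\<^sub>R x i))"
    unfolding f_def scaleR_sum_left by (subst sum.swap) (simp add: scaleR_sum_right)
  also have "\<dots> = (\<Sum>W\<in>V ` D. \<phi> W l *\<^sub>R node W)"
    using c(2) by (intro sum.cong) auto
  \<comment> \<open>Only the nodes with nonzero weight are known to lie in \<open>A l\<close>.\<close>
  also have "\<dots> = (\<Sum>W\<in>{W \<in> V ` D. \<phi> W l \<noteq> 0}. \<phi> W l *\<^sub>R node W)"
    by (rule sum.mono_neutral_right) (use D in auto)
  also have "\<dots> \<in> A l"
  proof (rule convex_sum)
    have "(\<Sum>W\<in>{W \<in> V ` D. \<phi> W l \<noteq> 0}. \<phi> W l) = (\<Sum>W\<in>V ` D. \<phi> W l)"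
      by (rule sum.mono_neutral_left) (use D in auto)
    then show "(\<Sum>W\<in>{W \<in> V ` D. \<phi> W l \<noteq> 0}. \<phi> W l) = 1"
      using sum1 l by simp
    fix W assume W: "W \<in> {W \<in> V ` D. \<phi> W l \<noteq> 0}"
    then have "l \<in> V (node W)" "node W \<in> ?X"
      using \<phi>(2) l node D by auto
    then show "node W \<in> A l"
      using UA V l by blast
  qed (use D A l \<phi>(1) in auto)
  finally show ?thesis using l by blast
qed

section \<open>Continuity of the selection and the intersection theorem\<close>

lemma continuous_on_scaleR_tvs:
  fixes a :: "'b::real_tvs"
  assumes "continuous_on S c"
  shows "continuous_on S (\<lambda>l. c l *\<^sub>R a)"
  unfolding continuous_on_def
proof
  fix l assume "l \<in> S"
  then have "(c \<longlongrightarrow> c l) (at l within S)"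
    using assms by (simp add: continuous_on_def)
  then have "filterlim (\<lambda>t. (c t, a)) (nhds (c l) \<times>\<^sub>F nhds a) (at l within S)"
    by (intro filterlim_Pair) auto
  then show "((\<lambda>t. c t *\<^sub>R a) \<longlongrightarrow> c l *\<^sub>R a) (at l within S)"
    using filterlim_compose[OF tendsto_scaleR_Pair_tvs] by fastforce
qed

lemma continuous_on_Cstar:
  assumes "g \<in> Cstar p" "i \<le> p"
  shows "continuous_on (standard_simplex p) (\<lambda>l. g l i)"
proof -
  obtain h where h: "continuous_on {0..1} (h i)" "\<forall>l\<in>standard_simplex p. g l i = h i (l i)"
    using assms unfolding Cstar_def by blast
  have "continuous_on (standard_simplex p) (\<lambda>l. h i (l i))"
    by (rule continuous_on_compose2[OF h(1)])
      (auto simp: standard_simplex_def intro: continuous_on_subset[OF continuous_on_product_coordinates])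
  then show ?thesis
    using h(2) by (simp cong: continuous_on_cong)
qed

theorem theorem1:
  fixes X :: "'a::real_tvs set" and Y :: "'b::real_tvs set"
    and T G :: "'a \<Rightarrow> 'b set"
  assumes "is_simplex X"
    and "Y \<noteq> {}" and "Hausdorff_space (top_of_set Y)"
    and "correspondence X Y T" and "correspondence X Y G"
    and "weakly_naturally_quasi_concave X T" and "compact_correspondence X Y T"
    and "\<And>y. y \<in> corr_image X T \<Longrightarrow> convex (corr_inverse X G y)"
    and "top_of_set Y closure_of corr_image X T = (\<Union>x\<in>X. top_of_set Y interior_of G x)"
  shows "\<exists>x\<in>X. T x \<inter> G x \<noteq> {}"
proof -
  obtain C where C: "finite C" "C \<noteq> {}" "X = convex hull C"
    using assms(1) by (auto simp: is_simplex_def)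
  obtain x where "bij_betw x {0..<card C} C"
    using ex_bij_betw_nat_finite[OF C(1)] by blast
  moreover define p where "p = card C - 1"
  moreover have "0 < card C" using C by (simp add: card_gt_0_iff)
  ultimately have x: "bij_betw x {..p} C"
    by (simp add: atLeast0LessThan lessThan_Suc_atMost[symmetric])
  let ?\<Delta> = "standard_simplex p" and ?m = "\<lambda>l. \<Sum>i\<le>p. l i *\<^sub>R x i"
  have inj: "inj_on x {..p}" and X: "X = convex hull (x ` {..p})"
    using x C(3) by (auto simp: bij_betw_def)
  have m: "?m l \<in> X" if "l \<in> ?\<Delta>" for l
    using that unfolding X convex_hull_standard_simplex[OF inj] by blast
  have "x ` {..p} \<subseteq> X" unfolding X by (rule hull_subset)
  then obtain y g where g: "g \<in> Cstar p" and yg: "\<forall>l\<in>?\<Delta>. (\<Sum>i\<le>p. g l i *\<^sub>R y i) \<in> T (?m l)"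
    using assms(6) inj unfolding weakly_naturally_quasi_concave_def by metis
  define s where "s l = (\<Sum>i\<le>p. g l i *\<^sub>R y i)" for l
  have cont: "continuous_on ?\<Delta> s"
    unfolding s_def
    by (intro continuous_on_sum continuous_on_scaleR_tvs continuous_on_Cstar[OF g]) auto
  have s: "s l \<in> T (?m l)" if "l \<in> ?\<Delta>" for l
    using yg that by (simp add: s_def)
  have sT: "s l \<in> corr_image X T" if "l \<in> ?\<Delta>" for l
    using s[OF that] m[OF that] by (auto simp: corr_image_def)
  have sY: "s \<in> ?\<Delta> \<rightarrow> Y"
    using s m assms(4) unfolding correspondence_def by blast
  have "\<exists>l\<in>?\<Delta>. ?m l \<in> corr_inverse X G (s l)"
  proof (rule fan_browder_barycentric[OF inj,
      where U = "\<lambda>z. ?\<Delta> \<inter> s -` (top_of_set Y interior_of G z)" and A = "\<lambda>l. corr_inverse X G (s l)"], fold X)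
    show "openin (top_of_set ?\<Delta>) (?\<Delta> \<inter> s -` (top_of_set Y interior_of G z))" for z
      using continuous_on_open_gen[OF sY] cont by auto
    have "s l \<in> (\<Union>z\<in>X. top_of_set Y interior_of G z)" if "l \<in> ?\<Delta>" for l
    proof -
      have "s l \<in> top_of_set Y closure_of corr_image X T"
        using closure_of_subset_Int[of "top_of_set Y" "corr_image X T"] sT sY that by auto
      then show ?thesis using assms(9) by simp
    qed
    then show "?\<Delta> \<subseteq> (\<Union>z\<in>X. ?\<Delta> \<inter> s -` (top_of_set Y interior_of G z))"
      by auto
    show "convex (corr_inverse X G (s l))" if "l \<in> ?\<Delta>" for l
      using assms(8) sT that by blast
    show "z \<in> corr_inverse X G (s l)"
      if "z \<in> X" "l \<in> ?\<Delta> \<inter> s -` (top_of_set Y interior_of G z)" for z l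
      using that interior_of_subset[of "top_of_set Y" "G z"] by (auto simp: corr_inverse_def)
  qed
  then obtain l where l: "l \<in> ?\<Delta>" "?m l \<in> corr_inverse X G (s l)"
    by blast
  have "s l \<in> T (?m l) \<inter> G (?m l)"
    using s l by (auto simp: corr_inverse_def)
  then show ?thesis
    using m[OF l(1)] by blast
qed

end
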